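(* Let $S_n$ be the symmetric group on $\{1,\dots,n\}$ and $\pi_n$ the uniform distribution on $S_n$. For any set $A\subseteq S_n$ with $\pi_n(A)\ge1/2$ and all $t\ge0$ $$\pi_n\big(d_T(\cdot,A)\ge t\big)\le2\exp\Big(-\frac{t^2}{64}\Big).$$
   Context: A permutation $\sigma\in S_n$ is identified with the vector $(\sigma(1),\dots,\sigma(n))\in\{1,\dots,n\}^n$. For $\omega=(\omega_1,\dots,\omega_n)\in\Omega^n$ and $A\subset\Omega^n$, Talagrand's convex distance is $$d_T(\omega,A)=\sup_{\alpha\in\mathbb R^n:\,|\alpha|_2=1}d_\alpha(\omega,A),\qquad d_\alpha(\omega,A)=\inf_{\omega'\in A}\sum_{i=1}^n|\alpha_i|\,\mathbf 1_{\omega_i\ne\omega_i'} ,$$ where $|\cdot|_2$ is the Euclidean norm. *)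

theory Defs
  imports "HOL-Probability.Probability" "HOL-Combinatorics.Permutations"
begin

text \<open>
  A point of \<open>\<Omega>\<^sup>n\<close> is a function \<open>\<omega> :: nat \<Rightarrow> 'a\<close> of which only the values on
  \<open>{1..n}\<close> are read, and likewise for a weight vector \<open>\<alpha>\<close> of \<open>\<real>\<^sup>n\<close>. A permutation
  \<open>\<sigma>\<close> of \<open>{1..n}\<close> is then itself the vector \<open>(\<sigma> 1, \<dots>, \<sigma> n)\<close>; since \<open>permutes\<close>
  requires \<open>\<sigma>\<close> to be the identity outside \<open>{1..n}\<close>, that vector determines \<open>\<sigma>\<close>.

  The distances are extended reals, so that infima and suprema over empty sets have
  their usual values (\<open>\<infinity>\<close> for \<open>A = {}\<close>, and \<open>-\<infinity>\<close> for the empty unit sphere of \<open>\<real>\<^sup>0\<close>).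
\<close>

definition sym_perms :: "nat \<Rightarrow> (nat \<Rightarrow> nat) set" where
  "sym_perms n = {\<sigma>. \<sigma> permutes {1..n}}"

definition uniform_perm :: "nat \<Rightarrow> (nat \<Rightarrow> nat) pmf" where
  "uniform_perm n = pmf_of_set (sym_perms n)"

definition weighted_hamming_dist ::
  "nat \<Rightarrow> (nat \<Rightarrow> real) \<Rightarrow> (nat \<Rightarrow> 'a) \<Rightarrow> (nat \<Rightarrow> 'a) set \<Rightarrow> ereal" where
  "weighted_hamming_dist n \<alpha> \<omega> A =
     (INF \<omega>'\<in>A. ereal (\<Sum>i=1..n. \<bar>\<alpha> i\<bar> * of_bool (\<omega> i \<noteq> \<omega>' i)))"

definition convex_dist :: "nat \<Rightarrow> (nat \<Rightarrow> 'a) \<Rightarrow> (nat \<Rightarrow> 'a) set \<Rightarrow> ereal" where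
  "convex_dist n \<omega> A =
     (SUP \<alpha>\<in>{\<alpha>. L2_set \<alpha> {1..n} = 1}. weighted_hamming_dist n \<alpha> \<omega> A)"

end

theory Submission
  imports Defs
begin

text \<open>
  Talagrand's induction, which gives the stronger exponent \<open>t\<^sup>2 / 16\<close>. By Cauchy--Schwarz,
  \<open>d\<^sub>T(\<sigma>, A)\<^sup>2\<close> is at most \<open>\<Sum>x. \<nu>(\<tau> x \<noteq> \<sigma> x)\<^sup>2\<close> for every probability measure \<open>\<nu>\<close> on \<open>A\<close>, so it
  suffices to choose \<open>\<nu> = \<nu>\<^sub>\<sigma>\<close> such that the exponential moment of one sixteenth of this cost is
  at most the reciprocal of the probability of \<open>A\<close>.

  Split \<open>S\<^sub>X\<close> into the fibres \<open>\<sigma> p = i\<close>, and let the fibre of \<open>A\<close> over \<open>j\<close> be a largest one.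
  For \<open>\<sigma> p = i\<close> mix, with weights \<open>1 - \<lambda>\<close> and \<open>\<lambda>\<close>, a measure on the fibre of \<open>A\<close> over \<open>i\<close> with a
  measure on the fibre over \<open>j\<close> that was chosen for \<open>(i j) \<circ> \<sigma>\<close>. The latter mismatches
  \<open>\<sigma>\<close> additionally at \<open>p\<close> and at \<open>s = \<sigma>\<inverse>(j)\<close>. To absorb the cross term at \<open>s\<close> through
  \<open>(a + \<lambda>)\<^sup>2 \<le> 2 a\<^sup>2 + 2 \<lambda>\<^sup>2\<close>, one distinguished position carries weight 2 in the induction
  hypothesis: \<open>p\<close> is chosen to be the distinguished position and \<open>s\<close> becomes
  the distinguished one for the smaller group. Since \<open>s\<close> varies with \<open>\<sigma>\<close> while its value \<open>j\<close> does
  not, the hypothesis is applied to inverses. Both extra mismatches cost \<open>4 \<lambda>\<^sup>2\<close> in total, and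
  optimising over \<open>\<lambda>\<close> is then the same calculation as for product spaces.
\<close>

hide_const (open) Finite_Cartesian_Product.transpose

section \<open>Mismatch probabilities and mixtures of measures\<close>

definition mismatch :: "('a \<Rightarrow> 'b) pmf \<Rightarrow> ('a \<Rightarrow> 'b) \<Rightarrow> 'a \<Rightarrow> real" where
  "mismatch \<nu> \<sigma> x = measure_pmf.prob \<nu> {\<tau>. \<tau> x \<noteq> \<sigma> x}"

text \<open>The vector \<open>mismatch \<nu> \<sigma>\<close> is the \<nu>-average of the 0-1
  vectors marking disagreement with \<sigma>, hence a point of their convex hull. The cost is its
  squared Euclidean norm on \<open>X\<close>, up to the doubled weight at \<open>p\<close>.\<close>

definition mismatch_cost :: "'a set \<Rightarrow> 'a \<Rightarrow> ('a \<Rightarrow> 'b) pmf \<Rightarrow> ('a \<Rightarrow> 'b) \<Rightarrow> real" where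
  "mismatch_cost X p \<nu> \<sigma> = (\<Sum>x\<in>X. (if x = p then 2 else 1) * (mismatch \<nu> \<sigma> x)\<^sup>2)"

definition mix_pmf :: "real \<Rightarrow> 'a pmf \<Rightarrow> 'a pmf \<Rightarrow> 'a pmf" where
  "mix_pmf l \<mu> \<nu> = bind_pmf (bernoulli_pmf l) (\<lambda>b. if b then \<nu> else \<mu>)"

lemma set_mix_pmf: "set_pmf (mix_pmf l \<mu> \<nu>) \<subseteq> set_pmf \<mu> \<union> set_pmf \<nu>"
  by (auto simp: mix_pmf_def split: if_splits)

lemma bernoulli_pmf_1: "bernoulli_pmf 1 = return_pmf True"
  by (rule pmf_eqI) (case_tac i; simp)

lemma mix_pmf_1: "mix_pmf 1 \<mu> \<nu> = \<nu>"
  by (simp add: mix_pmf_def bernoulli_pmf_1 bind_return_pmf)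

lemma prob_mix_pmf:
  assumes "0 \<le> l" "l \<le> 1"
  shows "measure_pmf.prob (mix_pmf l \<mu> \<nu>) S =
    (1 - l) * measure_pmf.prob \<mu> S + l * measure_pmf.prob \<nu> S"
proof -
  have "measure_pmf.prob (mix_pmf l \<mu> \<nu>) S =
    measure_pmf.expectation (bernoulli_pmf l) (\<lambda>b. measure_pmf.prob (if b then \<nu> else \<mu>) S)"
    unfolding mix_pmf_def
    by (subst measure_pmf_bind, subst measure_pmf.measure_bind[where N = "count_space UNIV"]) (auto simp: measure_subprob)
  also have "\<dots> = (1 - l) * measure_pmf.prob \<mu> S + l * measure_pmf.prob \<nu> S"
    using assms by simp
  finally show ?thesis .
qed

lemma mismatch_nonneg: "0 \<le> mismatch \<nu> \<sigma> x"
  and mismatch_le_1: "mismatch \<nu> \<sigma> x \<le> 1"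
  by (simp_all add: mismatch_def)

lemma mismatch_map_inj:
  assumes "inj f"
  shows "mismatch (map_pmf ((\<circ>) f) \<nu>) (f \<circ> \<sigma>) x = mismatch \<nu> \<sigma> x"
  using assms by (simp add: mismatch_def vimage_def inj_eq)

lemma mismatch_mix:
  assumes "0 \<le> l" "l \<le> 1"
  shows "mismatch (mix_pmf l \<mu> \<nu>) \<sigma> x = (1 - l) * mismatch \<mu> \<sigma> x + l * mismatch \<nu> \<sigma> x"
  using assms by (simp add: mismatch_def prob_mix_pmf)

lemma sum_mismatch_le_cost:
  "mismatch_cost X p \<nu> \<sigma> \<ge> (\<Sum>x\<in>X. (mismatch \<nu> \<sigma> x)\<^sup>2)"
  unfolding mismatch_cost_def by (intro sum_mono) auto

section \<open>Cost of a mixture of two fibre measures\<close>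

lemma power2_mix_le:
  fixes l a b :: real
  assumes "0 \<le> l" "l \<le> 1"
  shows "((1 - l) * a + l * b)\<^sup>2 \<le> (1 - l) * a\<^sup>2 + l * b\<^sup>2"
proof -
  have "(1 - l) * a\<^sup>2 + l * b\<^sup>2 - ((1 - l) * a + l * b)\<^sup>2 = l * (1 - l) * (a - b)\<^sup>2"
    by (simp add: power2_eq_square algebra_simps)
  also have "\<dots> \<ge> 0" using assms by simp
  finally show ?thesis by simp
qed

text \<open>This serves the position where the second measure may mismatch fully. The factor 2 on
  \<open>a\<^sup>2\<close> fits the doubled weight of a distinguished position, so only
  \<open>2 * l\<^sup>2\<close> counts as new cost.\<close>

lemma power2_shift_le:
  fixes l a :: real
  assumes "0 \<le> l" "l \<le> 1"
  shows "((1 - l) * a + l)\<^sup>2 \<le> (1 - l) * (2 * a\<^sup>2) + 2 * l\<^sup>2"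
proof -
  have "((1 - l) * a + l)\<^sup>2 \<le> 2 * ((1 - l) * a)\<^sup>2 + 2 * l\<^sup>2"
    using zero_le_power2[of "(1 - l) * a - l"] by (simp add: power2_eq_square algebra_simps)
  also have "((1 - l) * a)\<^sup>2 \<le> (1 - l) * a\<^sup>2"
    using power2_mix_le[OF assms, of a 0] by simp
  finally show ?thesis by simp
qed

text \<open>Let \<sigma> be \<open>transpose p i \<circ> \<rho>\<close>. Composing
  \<open>\<theta> \<circ> \<rho>\<close> with \<open>transpose p j\<close> gives
  \<open>transpose i j \<circ> \<sigma>\<close>, which lies in the fibre over \<open>j\<close>.
  Convexity of the square handles the positions where \<sigma> takes neither of the values
  \<open>i\<close> and \<open>j\<close>; the doubled position \<open>p\<close> and the position of
  the value \<open>j\<close> add at most \<open>2 * l\<^sup>2\<close> each.\<close>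

lemma mixture_cost_le:
  fixes \<mu> \<nu> :: "('a \<Rightarrow> 'a) pmf" and i j :: 'a
  assumes X: "finite X" "p \<in> X" and l: "0 \<le> l" "l \<le> 1"
    and \<rho>: "\<rho> permutes (X - {p})"
    and \<mu>: "set_pmf \<mu> \<subseteq> {\<pi>. \<pi> permutes (X - {p})}"
  defines "\<theta> \<equiv> transpose p j \<circ> transpose i j \<circ> transpose p i"
  shows "mismatch_cost X p
      (mix_pmf l (map_pmf ((\<circ>) (transpose p i)) \<mu>) (map_pmf ((\<circ>) (transpose p j)) \<nu>))
      (transpose p i \<circ> \<rho>)
    \<le> 4 * l\<^sup>2 + (1 - l) * mismatch_cost (X - {p}) (inv \<rho> (transpose p i j)) \<mu> \<rho>
        + l * mismatch_cost (X - {p}) p \<nu> (\<theta> \<circ> \<rho>)"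
proof -
  define Y where "Y = X - {p}"
  define z where "z = mismatch
      (mix_pmf l (map_pmf ((\<circ>) (transpose p i)) \<mu>) (map_pmf ((\<circ>) (transpose p j)) \<nu>))
      (transpose p i \<circ> \<rho>)"
  define a where "a = mismatch \<mu> \<rho>"
  define b where "b = mismatch \<nu> (\<theta> \<circ> \<rho>)"
  \<comment> \<open>At \<open>s\<close> the permutation \<open>transpose p i \<circ> \<rho>\<close>
    takes the value \<open>j\<close>. If \<open>i = j\<close>, then \<open>s\<close> is
    \<open>p\<close>, outside \<open>Y\<close>.\<close>
  define s where "s = inv \<rho> (transpose p i j)"
  have z: "z x = (1 - l) * a x
      + l * mismatch (map_pmf ((\<circ>) (transpose p j)) \<nu>) (transpose p i \<circ> \<rho>) x" for x
    using l unfolding z_def a_def by (simp add: mismatch_mix mismatch_map_inj)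
  have z0: "0 \<le> z x" for x unfolding z_def by (rule mismatch_nonneg)
  have zle: "z x \<le> (1 - l) * a x + l" for x
    using mult_left_mono[OF mismatch_le_1 l(1)] unfolding z by fastforce
  have ap: "a p = 0"
  proof -
    have "\<rho> p = p" using \<rho> by (simp add: permutes_def)
    moreover have "\<pi> p = p" if "\<pi> \<in> set_pmf \<mu>" for \<pi>
      using \<mu> that by (auto simp: permutes_def)
    ultimately show ?thesis
      unfolding a_def mismatch_def by (auto simp: measure_pmf_zero_iff)
  qed
  have zp: "(z p)\<^sup>2 \<le> l\<^sup>2"
    using zle[of p] z0[of p] ap by (intro power_mono) auto
  have zx: "(z x)\<^sup>2 \<le> (1 - l) * ((if x = s then 2 else 1) * (a x)\<^sup>2) + l * (b x)\<^sup>2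
      + (if x = s then 2 * l\<^sup>2 else 0)" if x: "x \<in> Y" for x
  proof (cases "x = s")
    case True
    have "(z x)\<^sup>2 \<le> ((1 - l) * a x + l)\<^sup>2" using zle z0 by (intro power_mono) auto
    also have "\<dots> \<le> (1 - l) * (2 * (a x)\<^sup>2) + 2 * l\<^sup>2" by (rule power2_shift_le[OF l])
    finally have "(z x)\<^sup>2 \<le> (1 - l) * (2 * (a x)\<^sup>2) + 2 * l\<^sup>2" .
    moreover have "0 \<le> l * (b x)\<^sup>2" using l by simp
    ultimately show ?thesis unfolding if_P[OF True] by linarith
  next
    case False
    have 1: "\<rho> x \<noteq> transpose p i j"
      using False permutes_inverses(2)[OF \<rho>] unfolding s_def by metis
    have 2: "\<rho> x \<noteq> p" using x permutes_in_image[OF \<rho>] unfolding Y_def by blast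
    \<comment> \<open>The values \<open>i\<close> and \<open>j\<close> are taken only at
      \<open>p\<close> and \<open>s\<close>, so exchanging them changes nothing at
      \<open>x\<close>.\<close>
    have "transpose p i (\<rho> x) \<noteq> j" using 1 by (metis transpose_involutory)
    moreover have "transpose p i (\<rho> x) \<noteq> i" using 2 by (metis transpose_apply_first transpose_involutory)
    ultimately have "(transpose p i \<circ> \<rho>) x = (transpose p j \<circ> (\<theta> \<circ> \<rho>)) x"
      by (simp add: \<theta>_def)
    then have "mismatch (map_pmf ((\<circ>) (transpose p j)) \<nu>) (transpose p i \<circ> \<rho>) x =
        mismatch (map_pmf ((\<circ>) (transpose p j)) \<nu>) (transpose p j \<circ> (\<theta> \<circ> \<rho>)) x"
      by (simp add: mismatch_def)
    also have "\<dots> = b x" unfolding b_def by (simp add: mismatch_map_inj)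
    finally have "z x = (1 - l) * a x + l * b x" by (simp add: z)
    then show ?thesis using power2_mix_le[OF l, of "a x" "b x"] False by simp
  qed
  have fin: "finite Y" using X by (simp add: Y_def)
  have "mismatch_cost X p
      (mix_pmf l (map_pmf ((\<circ>) (transpose p i)) \<mu>) (map_pmf ((\<circ>) (transpose p j)) \<nu>))
      (transpose p i \<circ> \<rho>) = 2 * (z p)\<^sup>2 + (\<Sum>x\<in>Y. (z x)\<^sup>2)"
    unfolding mismatch_cost_def z_def[symmetric] Y_def
    by (subst sum.remove[OF X]) (auto intro!: sum.cong)
  also have "\<dots> \<le> 2 * l\<^sup>2 + (\<Sum>x\<in>Y. (1 - l) * ((if x = s then 2 else 1) * (a x)\<^sup>2) + l * (b x)\<^sup>2
      + (if x = s then 2 * l\<^sup>2 else 0))"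
    by (intro add_mono sum_mono zx) (use zp in auto)
  also have "\<dots> \<le> 2 * l\<^sup>2 + ((1 - l) * mismatch_cost Y s \<mu> \<rho>
      + l * mismatch_cost Y p \<nu> (\<theta> \<circ> \<rho>) + 2 * l\<^sup>2)"
  proof -
    have "(\<Sum>x\<in>Y. (b x)\<^sup>2) \<le> mismatch_cost Y p \<nu> (\<theta> \<circ> \<rho>)"
      unfolding b_def by (rule sum_mismatch_le_cost)
    then have "l * (\<Sum>x\<in>Y. (b x)\<^sup>2) \<le> l * mismatch_cost Y p \<nu> (\<theta> \<circ> \<rho>)"
      using l by (intro mult_left_mono) auto
    \<comment> \<open>Only an inequality, because \<open>s\<close> may lie outside
      \<open>Y\<close>.\<close>
    moreover have "(\<Sum>x\<in>Y. if x = s then 2 * l\<^sup>2 else 0) \<le> 2 * l\<^sup>2"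
      using fin by (simp add: sum.delta)
    moreover have "mismatch_cost Y s \<mu> \<rho> = (\<Sum>x\<in>Y. (if x = s then 2 else 1) * (a x)\<^sup>2)"
      by (simp add: mismatch_cost_def a_def)
    ultimately show ?thesis by (simp only: sum.distrib flip: sum_distrib_left)
  qed
  finally show ?thesis unfolding Y_def s_def by simp
qed

section \<open>Exponential moments and the choice of the mixing weight\<close>

lemma exp_mix_le:
  fixes l g f a b :: real
  assumes "0 \<le> l" "l \<le> 1" "0 < a" "0 < b"
  shows "exp ((1 - l) * g + l * f)
    \<le> exp ((1 - l) * ln a + l * ln b) * ((1 - l) * (exp g / a) + l * (exp f / b))"
proof -
  have "exp ((1 - l) * (g - ln a) + l * (f - ln b))
      \<le> (1 - l) * exp (g - ln a) + l * exp (f - ln b)"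
    using convex_onD[OF exp_convex, of l "g - ln a" "f - ln b"] assms by simp
  then have "exp ((1 - l) * (g - ln a) + l * (f - ln b))
      \<le> (1 - l) * (exp g / a) + l * (exp f / b)"
    using assms by (simp add: exp_diff)
  then have "exp ((1 - l) * ln a + l * ln b) * exp ((1 - l) * (g - ln a) + l * (f - ln b))
    \<le> exp ((1 - l) * ln a + l * ln b) * ((1 - l) * (exp g / a) + l * (exp f / b))"
    by simp
  then show ?thesis by (simp add: algebra_simps flip: exp_add)
qed

text \<open>Hoelder's inequality with exponents 1/(1-l) and 1/l. After normalising by
  \<open>a\<close> and \<open>b\<close>, convexity of \<open>exp\<close> is applied
  pointwise.\<close>

lemma sum_exp_mix_le:
  fixes g f :: "'a \<Rightarrow> real"
  assumes l: "0 \<le> l" "l \<le> 1" and ab: "0 < a" "0 < b"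
    and g: "(\<Sum>x\<in>S. exp (g x)) \<le> a" and f: "(\<Sum>x\<in>S. exp (f x)) \<le> b"
  shows "(\<Sum>x\<in>S. exp ((1 - l) * g x + l * f x)) \<le> exp ((1 - l) * ln a + l * ln b)"
proof -
  have "(\<Sum>x\<in>S. exp ((1 - l) * g x + l * f x))
      \<le> (\<Sum>x\<in>S. exp ((1 - l) * ln a + l * ln b) * ((1 - l) * (exp (g x) / a) + l * (exp (f x) / b)))"
    by (intro sum_mono exp_mix_le l ab)
  also have "\<dots> = exp ((1 - l) * ln a + l * ln b)
      * ((1 - l) * ((\<Sum>x\<in>S. exp (g x)) / a) + l * ((\<Sum>x\<in>S. exp (f x)) / b))"
    by (simp only: sum.distrib sum_divide_distrib flip: sum_distrib_left)
  also have "\<dots> \<le> exp ((1 - l) * ln a + l * ln b) * ((1 - l) * 1 + l * 1)"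
    using l ab g f by (intro mult_left_mono add_mono) auto
  finally show ?thesis by simp
qed

lemma ln_one_plus_ge_quadratic:
  fixes v :: real
  assumes "0 \<le> v"
  shows "v - v\<^sup>2 / 2 \<le> ln (1 + v)"
proof -
  have "ln (1 + 0) - 0 + 0\<^sup>2 / 2 \<le> ln (1 + v) - v + v\<^sup>2 / 2"
  proof (rule DERIV_nonneg_imp_nondecreasing[OF assms])
    fix x :: real
    assume x: "0 \<le> x" "x \<le> v"
    have "((\<lambda>v. ln (1 + v) - v + v\<^sup>2 / 2) has_real_derivative x\<^sup>2 / (1 + x)) (at x)"
      using x by (auto intro!: derivative_eq_intros simp: field_simps power2_eq_square)
    then show "\<exists>y. ((\<lambda>v. ln (1 + v) - v + v\<^sup>2 / 2) has_real_derivative y) (at x) \<and> 0 \<le> y"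
      using x by (intro exI[of _ "x\<^sup>2 / (1 + x)"]) auto
  qed
  then show ?thesis by simp
qed

text \<open>Follows from the lower Taylor bound for \<open>exp u\<close>, since the quadratics for
  \<open>u\<close> and \<open>- u\<close> multiply to 1 + u^4/4.\<close>

lemma exp_minus_le_quadratic:
  fixes u :: real
  assumes "0 \<le> u"
  shows "exp (- u) \<le> 1 - u + u\<^sup>2 / 2"
proof -
  have pos: "0 < 1 - u + u\<^sup>2 / 2"
    using zero_le_power2[of "u - 1"] by (simp add: power2_eq_square algebra_simps)
  have "1 \<le> (1 + u + u\<^sup>2 / 2) * (1 - u + u\<^sup>2 / 2)"
  proof -
    have "(1 + u + u\<^sup>2 / 2) * (1 - u + u\<^sup>2 / 2) = 1 + (u\<^sup>2 / 2)\<^sup>2"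
      by (simp add: power2_eq_square algebra_simps)
    then show ?thesis by simp
  qed
  also have "\<dots> \<le> exp u * (1 - u + u\<^sup>2 / 2)"
    using exp_lower_Taylor_quadratic[OF assms] pos by (intro mult_right_mono) auto
  finally show ?thesis by (simp add: exp_minus field_simps)
qed

text \<open>With u = -ln r, the left side is a parabola in \<open>l\<close> with minimum at 2u. That
  weight is admissible for u <= 1/2; beyond that the endpoint 1 is used.\<close>

lemma interpolation_bound:
  fixes r :: real
  assumes "0 < r" "r \<le> 1"
  shows "\<exists>l. 0 \<le> l \<and> l \<le> 1 \<and> l\<^sup>2 / 4 - (1 - l) * ln r \<le> ln (2 - r)"
proof -
  define u where "u = - ln r"
  have u: "0 \<le> u" "r = exp (- u)" using assms by (auto simp: u_def)
  show ?thesis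
  proof (cases "u \<le> 1 / 2")
    case True
    \<comment> \<open>By the quadratic bound on \<open>exp (- u)\<close>, \<open>2 - r\<close> is at
      least \<open>1 + v\<close>.\<close>
    define v where "v = u - u\<^sup>2 / 2"
    have uu: "u\<^sup>2 \<le> u" using True u mult_right_mono[of u 1 u] by (simp add: power2_eq_square)
    have v: "0 \<le> v" "v \<le> u" using uu u by (auto simp: v_def)
    have "u - u\<^sup>2 \<le> v - v\<^sup>2 / 2"
      using power_mono[OF v(2,1), of 2] by (simp add: v_def)
    also have "\<dots> \<le> ln (1 + v)" by (rule ln_one_plus_ge_quadratic[OF v(1)])
    also have "\<dots> \<le> ln (2 - r)"
      using exp_minus_le_quadratic[OF u(1)] v by (simp add: v_def u(2))
    finally have low: "u - u\<^sup>2 \<le> ln (2 - r)" .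
    have "(2 * u)\<^sup>2 / 4 - (1 - 2 * u) * ln r = u - u\<^sup>2"
      by (simp add: u_def power2_eq_square algebra_simps)
    then show ?thesis using low True u by (intro exI[of _ "2 * u"]) auto
  next
    case False
    \<comment> \<open>At \<open>l = 1\<close> it remains to compare 1/4 with
      \<open>ln (2 - r)\<close>; the crude values r <= 5/8 and 3/8 - 9/128 > 1/4 suffice.\<close>
    then have "r \<le> exp (- (1/2))" using u by simp
    also have "\<dots> \<le> 5/8"
      using exp_minus_le_quadratic[of "1/2"] by (simp add: power2_eq_square)
    finally have "ln (1 + 3/8) \<le> ln (2 - r)" by simp
    moreover have "1/4 \<le> ln (1 + 3/8 :: real)"
      using ln_one_plus_ge_quadratic[of "3/8"] by (simp add: power2_eq_square)
    ultimately show ?thesis by (intro exI[of _ 1]) auto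
  qed
qed

section \<open>The induction hypothesis and its form for inverses\<close>

text \<open>The substitution \<open>\<sigma> \<mapsto> \<sigma>\<inverse>\<close> turns a distinguished position into a distinguished value.\<close>

lemma mismatch_cost_inv:
  assumes "\<sigma> permutes X" "set_pmf \<nu> \<subseteq> {\<tau>. \<tau> permutes X}"
  shows "mismatch_cost X (inv \<sigma> q) (map_pmf inv \<nu>) \<sigma> = mismatch_cost X q \<nu> (inv \<sigma>)"
proof -
  have mis: "mismatch (map_pmf inv \<nu>) \<sigma> x = mismatch \<nu> (inv \<sigma>) (\<sigma> x)" for x
  proof -
    \<comment> \<open>Both sides deny that \<tau> maps \<open>\<sigma> x\<close> to
      \<open>x\<close>.\<close>
    have "(inv \<tau> x \<noteq> \<sigma> x) = (\<tau> (\<sigma> x) \<noteq> inv \<sigma> (\<sigma> x))" if "\<tau> \<in> set_pmf \<nu>" for \<tau>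
    proof -
      have "\<tau> permutes X" using that assms(2) by blast
      then show ?thesis using assms(1) by (metis permutes_inverses)
    qed
    then show ?thesis unfolding mismatch_def
      by (auto intro!: measure_pmf.finite_measure_eq_AE simp: AE_measure_pmf_iff)
  qed
  have w: "x = inv \<sigma> q \<longleftrightarrow> \<sigma> x = q" for x
    using assms(1) by (metis permutes_inverses)
  show ?thesis
    unfolding mismatch_cost_def
    using sum.reindex_bij_betw[OF permutes_imp_bij[OF assms(1)],
        of "\<lambda>y. (if y = q then 2 else 1) * (mismatch \<nu> (inv \<sigma>) y)\<^sup>2"]
    by (simp add: mis w)
qed

text \<open>For \<open>p \<notin> X\<close> all weights are 1.\<close>

definition concentrated :: "'a set \<Rightarrow> bool" where
  "concentrated X \<longleftrightarrow> (\<forall>A p. A \<subseteq> {\<sigma>. \<sigma> permutes X} \<longrightarrow> A \<noteq> {} \<longrightarrow>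
    (\<exists>\<nu>. (\<forall>\<sigma>. set_pmf (\<nu> \<sigma>) \<subseteq> A) \<and>
      real (card A) * (\<Sum>\<sigma> | \<sigma> permutes X. exp (mismatch_cost X p (\<nu> \<sigma>) \<sigma> / 16))
        \<le> (fact (card X))\<^sup>2))"

lemma concentratedD:
  assumes "concentrated X" "A \<subseteq> {\<sigma>. \<sigma> permutes X}" "A \<noteq> {}"
  obtains \<nu> where "\<And>\<sigma>. set_pmf (\<nu> \<sigma>) \<subseteq> A"
    "real (card A) * (\<Sum>\<sigma> | \<sigma> permutes X. exp (mismatch_cost X p (\<nu> \<sigma>) \<sigma> / 16)) \<le> (fact (card X))\<^sup>2"
  using assms unfolding concentrated_def by blast

text \<open>In the fibre argument the distinguished position moves with \<sigma> and only its value
  \<open>q\<close> stays fixed. Inversion is a bijection that exchanges positions and values, so the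
  hypothesis for the set of inverses of \<open>A\<close>, with fixed position \<open>q\<close>,
  yields this form.\<close>

lemma concentrated_value:
  assumes "concentrated X" "A \<subseteq> {\<sigma>. \<sigma> permutes X}" "A \<noteq> {}"
  obtains \<nu> where "\<And>\<sigma>. set_pmf (\<nu> \<sigma>) \<subseteq> A"
    "real (card A) * (\<Sum>\<sigma> | \<sigma> permutes X. exp (mismatch_cost X (inv \<sigma> q) (\<nu> \<sigma>) \<sigma> / 16))
      \<le> (fact (card X))\<^sup>2"
proof -
  have A': "inv ` A \<subseteq> {\<sigma>. \<sigma> permutes X}" using assms(2) by (auto intro: permutes_inv)
  have ii: "inv (inv \<tau>) = \<tau>" if "\<tau> \<in> A" for \<tau>
    using that assms(2) by (auto intro: permutes_inv_inv)
  have "inj_on inv A" using ii by (metis inj_onI)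
  then have card: "card (inv ` A) = card A" by (rule card_image)
  obtain \<nu> where \<nu>: "\<And>\<sigma>. set_pmf (\<nu> \<sigma>) \<subseteq> inv ` A"
    "real (card (inv ` A)) * (\<Sum>\<sigma> | \<sigma> permutes X. exp (mismatch_cost X q (\<nu> \<sigma>) \<sigma> / 16)) \<le> (fact (card X))\<^sup>2"
    using concentratedD[OF assms(1) A', of q] assms(3) by blast
  have "(\<Sum>\<sigma> | \<sigma> permutes X. exp (mismatch_cost X q (\<nu> \<sigma>) \<sigma> / 16))
      = (\<Sum>\<sigma> | \<sigma> permutes X. exp (mismatch_cost X q (\<nu> (inv \<sigma>)) (inv \<sigma>) / 16))"
    by (rule sum.reindex_bij_witness[of _ inv inv])
       (auto simp: permutes_inv_inv permutes_inv)
  also have "\<dots> = (\<Sum>\<sigma> | \<sigma> permutes X.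
      exp (mismatch_cost X (inv \<sigma> q) (map_pmf inv (\<nu> (inv \<sigma>))) \<sigma> / 16))"
    using \<nu>(1) A' by (intro sum.cong refl) (subst mismatch_cost_inv, auto)
  finally show ?thesis
    using \<nu> card ii by (intro that[of "\<lambda>\<sigma>. map_pmf inv (\<nu> (inv \<sigma>))"]) (fastforce simp: image_subset_iff)+
qed

lemma concentrated_empty: "concentrated {}"
proof (unfold concentrated_def, intro allI impI)
  fix A :: "('a \<Rightarrow> 'a) set" and p
  assume A: "A \<subseteq> {\<sigma>. \<sigma> permutes {}}" "A \<noteq> {}"
  then have A_eq: "A = {id}" by auto
  show "\<exists>\<nu>. (\<forall>\<sigma>. set_pmf (\<nu> \<sigma>) \<subseteq> A) \<and>
      real (card A) * (\<Sum>\<sigma> | \<sigma> permutes {}. exp (mismatch_cost {} p (\<nu> \<sigma>) \<sigma> / 16))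
        \<le> (fact (card ({} :: 'a set)))\<^sup>2"
    by (rule exI[of _ "\<lambda>_. return_pmf id"]) (simp add: A_eq mismatch_cost_def)
qed

section \<open>Decomposition into fibres and the induction step\<close>

text \<open>The coset decomposition over the stabiliser of \<open>p\<close>: the first coordinate is
  recovered as the value at \<open>p\<close>.\<close>

lemma bij_betw_transpose_permutes:
  assumes "p \<in> X"
  shows "bij_betw (\<lambda>(i, \<rho>). transpose p i \<circ> \<rho>)
    (X \<times> {\<rho>. \<rho> permutes (X - {p})}) {\<sigma>. \<sigma> permutes X}"
  unfolding bij_betw_def
proof
  have at: "(transpose p i \<circ> \<rho>) p = i" if "\<rho> permutes (X - {p})" for i \<rho>
    using that by (simp add: permutes_def)
  show "inj_on (\<lambda>(i, \<rho>). transpose p i \<circ> \<rho>) (X \<times> {\<rho>. \<rho> permutes (X - {p})})"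
  proof (rule inj_onI, clarsimp)
    fix i \<rho> j \<pi>
    assume *: "\<rho> permutes (X - {p})" "\<pi> permutes (X - {p})"
      "transpose p i \<circ> \<rho> = transpose p j \<circ> \<pi>"
    then have "i = j" using at by metis
    with *(3) show "i = j \<and> \<rho> = \<pi>"
      by (metis comp_assoc id_comp transpose_comp_involutory)
  qed
  show "(\<lambda>(i, \<rho>). transpose p i \<circ> \<rho>) ` (X \<times> {\<rho>. \<rho> permutes (X - {p})}) = {\<sigma>. \<sigma> permutes X}"
    using permutes_insert[of p "X - {p}"] assms by (simp add: insert_absorb)
qed

text \<open>\<open>B\<close> and \<open>C\<close> stand for the traces of \<open>A\<close> in the
  fibres over \<open>i\<close> and \<open>j\<close>. For nonempty \<open>B\<close>, Hoelder's
  inequality combines the moment bounds N/|B| and N/|C| into N/|C| times r^(-(1-l)) exp(l^2/4),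
  where r = |B|/|C|; a suitable \<open>l\<close> makes the last factor at most 2 - r.\<close>

lemma concentrated_fibre:
  assumes X: "finite X" "p \<in> X" "i \<in> X" "j \<in> X" and conc: "concentrated (X - {p})"
    and B: "B \<subseteq> {\<pi>. \<pi> permutes (X - {p})}" "(\<circ>) (transpose p i) ` B \<subseteq> A"
    and C: "C \<subseteq> {\<pi>. \<pi> permutes (X - {p})}" "(\<circ>) (transpose p j) ` C \<subseteq> A"
    and "C \<noteq> {}" "card B \<le> card C"
  shows "\<exists>\<nu>. (\<forall>\<rho>. set_pmf (\<nu> \<rho>) \<subseteq> A) \<and>
    real (card C) * (\<Sum>\<rho> | \<rho> permutes (X - {p}).
        exp (mismatch_cost X p (\<nu> \<rho>) (transpose p i \<circ> \<rho>) / 16))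
      \<le> (fact (card (X - {p})))\<^sup>2 * (2 - real (card B) / real (card C))"
proof -
  define Y where "Y = X - {p}"
  define N :: real where "N = (fact (card Y))\<^sup>2"
  define \<theta> where "\<theta> = transpose p j \<circ> transpose i j \<circ> transpose p i"
  define r where "r = real (card B) / real (card C)"
  have finY: "finite Y" using X by (simp add: Y_def)
  have finP: "finite {\<rho>. \<rho> permutes Y}" using finY by (rule finite_permutations)
  have finB: "finite B" and finC: "finite C"
    using B(1) C(1) finP finite_subset unfolding Y_def by blast+
  have cardC: "0 < real (card C)" using finC \<open>C \<noteq> {}\<close> by (simp add: card_gt_0_iff)
  have N: "0 < N" by (simp add: N_def)
  have \<theta>X: "\<theta> permutes X" unfolding \<theta>_def
    using X by (intro permutes_compose permutes_swap_id)
  \<comment> \<open>\<theta> carries \<open>p\<close> via \<open>i\<close> and \<open>j\<close> back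
    to \<open>p\<close>.\<close>
  have \<theta>: "\<theta> permutes Y"
    by (rule permutes_superset[OF \<theta>X]) (auto simp: Y_def \<theta>_def)
  obtain \<nu> where \<nu>: "\<And>\<sigma>. set_pmf (\<nu> \<sigma>) \<subseteq> C"
    "real (card C) * (\<Sum>\<sigma> | \<sigma> permutes Y. exp (mismatch_cost Y p (\<nu> \<sigma>) \<sigma> / 16)) \<le> N"
    using concentratedD[OF conc C(1) \<open>C \<noteq> {}\<close>, of p] unfolding Y_def N_def by blast
  define F where "F = (\<lambda>\<rho>. mismatch_cost Y p (\<nu> (\<theta> \<circ> \<rho>)) (\<theta> \<circ> \<rho>) / 16)"
  define b where "b = N / real (card C)"
  have b: "0 < b" using N cardC by (simp add: b_def)
  have "(\<Sum>\<rho> | \<rho> permutes Y. exp (F \<rho>))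
      = (\<Sum>\<sigma> | \<sigma> permutes Y. exp (mismatch_cost Y p (\<nu> \<sigma>) \<sigma> / 16))"
    unfolding F_def by (rule setum_permutations_compose_left[OF \<theta>, symmetric])
  then have F: "(\<Sum>\<rho> | \<rho> permutes Y. exp (F \<rho>)) \<le> b"
    using \<nu>(2) cardC by (simp add: b_def field_simps)
  define G where "G = (\<lambda>\<mu> \<rho>. mismatch_cost Y (inv \<rho> (transpose p i j)) (\<mu> \<rho>) \<rho> / 16)"
  obtain l \<mu> a where l: "0 \<le> l" "l \<le> 1" and a: "0 < a"
    and \<mu>: "\<And>\<rho>. set_pmf (\<mu> \<rho>) \<subseteq> {\<pi>. \<pi> permutes Y}" "l = 1 \<or> (\<forall>\<rho>. set_pmf (\<mu> \<rho>) \<subseteq> B)"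
    and G: "(\<Sum>\<rho> | \<rho> permutes Y. exp (G \<mu> \<rho>)) \<le> a"
    and opt: "exp (l\<^sup>2 / 4) * exp ((1 - l) * ln a + l * ln b) \<le> b * (2 - r)"
  proof (cases "B = {}")
    case True
    \<comment> \<open>No measure lives on an empty fibre, so all weight goes to \<nu>. Here r = 0,
      and what remains is exp(1/4) <= 2.\<close>
    have "1 / 4 \<le> ln (2 - r)"
      using True ln_one_plus_ge_quadratic[of 1] by (simp add: r_def)
    then have "exp (1 / 4) \<le> exp (ln (2 - r))" by simp
    then have "exp (1 / 4) \<le> 2 - r" using True by (simp add: r_def)
    \<comment> \<open>With \<open>l = 1\<close> the first component is a mere filler: \<nu> is
      reused for it, and adding 1 to its sum gives an evidently positive bound.\<close>
    moreover have "0 < (\<Sum>\<rho> | \<rho> permutes Y. exp (G \<nu> \<rho>)) + 1"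
      by (intro add_nonneg_pos sum_nonneg) auto
    ultimately show ?thesis
      using \<nu>(1) C(1) b unfolding Y_def[symmetric]
      by (intro that[of 1 "(\<Sum>\<rho> | \<rho> permutes Y. exp (G \<nu> \<rho>)) + 1" \<nu>]) auto
  next
    case False
    then have cardB: "0 < real (card B)" using finB by (simp add: card_gt_0_iff)
    have r: "0 < r" "r \<le> 1" using cardB cardC \<open>card B \<le> card C\<close> by (auto simp: r_def)
    obtain \<mu> where \<mu>: "\<And>\<sigma>. set_pmf (\<mu> \<sigma>) \<subseteq> B"
      "real (card B) * (\<Sum>\<sigma> | \<sigma> permutes Y. exp (G \<mu> \<sigma>)) \<le> N"
      using concentrated_value[OF conc B(1) False, of "transpose p i j"]
      unfolding Y_def N_def G_def by blast
    obtain l where l: "0 \<le> l" "l \<le> 1" "l\<^sup>2 / 4 - (1 - l) * ln r \<le> ln (2 - r)"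
      using interpolation_bound[OF r] by blast
    define a where "a = N / real (card B)"
    have a: "0 < a" using N cardB by (simp add: a_def)
    have "ln a - ln b = - ln r"
      using N cardB cardC by (simp add: a_def b_def r_def ln_div)
    then have lna: "ln a = ln b - ln r" by simp
    \<comment> \<open>Since a/b = 1/r, the exponent is \<open>ln b\<close> plus the expression
      bounded in \<open>interpolation_bound\<close>.\<close>
    have "exp (l\<^sup>2 / 4) * exp ((1 - l) * ln a + l * ln b)
        = exp (ln b + (l\<^sup>2 / 4 - (1 - l) * ln r))"
      by (simp add: lna algebra_simps flip: exp_add)
    also have "\<dots> \<le> exp (ln b + ln (2 - r))" using l(3) by simp
    also have "\<dots> = b * (2 - r)" using b r by (simp add: exp_add)
    finally show ?thesis
      using \<mu> l a cardB B(1) unfolding Y_def[symmetric]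
      by (intro that[of l a \<mu>]) (auto simp: a_def field_simps)
  qed
  define \<kappa> where "\<kappa> = (\<lambda>\<rho>. mix_pmf l (map_pmf ((\<circ>) (transpose p i)) (\<mu> \<rho>))
    (map_pmf ((\<circ>) (transpose p j)) (\<nu> (\<theta> \<circ> \<rho>))))"
  have "set_pmf (\<kappa> \<rho>) \<subseteq> A" for \<rho>
  proof -
    have 1: "set_pmf (map_pmf ((\<circ>) (transpose p j)) (\<nu> (\<theta> \<circ> \<rho>))) \<subseteq> A"
      using \<nu>(1)[of "\<theta> \<circ> \<rho>"] C(2) by auto
    show ?thesis
    proof (cases "l = 1")
      case True
      then show ?thesis using 1 by (simp add: \<kappa>_def mix_pmf_1)
    next
      case False
      then have "set_pmf (map_pmf ((\<circ>) (transpose p i)) (\<mu> \<rho>)) \<subseteq> A"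
        using \<mu>(2) B(2) by auto
      then show ?thesis
        using 1 unfolding \<kappa>_def by (intro order_trans[OF set_mix_pmf] Un_least)
    qed
  qed
  moreover have "real (card C) * (\<Sum>\<rho> | \<rho> permutes Y.
        exp (mismatch_cost X p (\<kappa> \<rho>) (transpose p i \<circ> \<rho>) / 16)) \<le> N * (2 - r)"
  proof -
    have "(\<Sum>\<rho> | \<rho> permutes Y. exp (mismatch_cost X p (\<kappa> \<rho>) (transpose p i \<circ> \<rho>) / 16))
        \<le> (\<Sum>\<rho> | \<rho> permutes Y. exp (l\<^sup>2 / 4) * exp ((1 - l) * G \<mu> \<rho> + l * F \<rho>))"
    proof (rule sum_mono)
      fix \<rho> assume "\<rho> \<in> {\<rho>. \<rho> permutes Y}"
      then have \<rho>: "\<rho> permutes (X - {p})" by (simp add: Y_def)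
      have \<mu>\<rho>: "set_pmf (\<mu> \<rho>) \<subseteq> {\<pi>. \<pi> permutes (X - {p})}"
        using \<mu>(1)[of \<rho>] by (simp add: Y_def)
      have "mismatch_cost X p (\<kappa> \<rho>) (transpose p i \<circ> \<rho>)
          \<le> 4 * l\<^sup>2 + (1 - l) * mismatch_cost Y (inv \<rho> (transpose p i j)) (\<mu> \<rho>) \<rho>
            + l * mismatch_cost Y p (\<nu> (\<theta> \<circ> \<rho>)) (\<theta> \<circ> \<rho>)"
        unfolding \<kappa>_def Y_def \<theta>_def by (rule mixture_cost_le[OF X(1,2) l \<rho> \<mu>\<rho>])
      then have "mismatch_cost X p (\<kappa> \<rho>) (transpose p i \<circ> \<rho>) / 16
          \<le> l\<^sup>2 / 4 + ((1 - l) * G \<mu> \<rho> + l * F \<rho>)"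
        by (simp add: G_def F_def)
      then show "exp (mismatch_cost X p (\<kappa> \<rho>) (transpose p i \<circ> \<rho>) / 16)
          \<le> exp (l\<^sup>2 / 4) * exp ((1 - l) * G \<mu> \<rho> + l * F \<rho>)"
        by (simp flip: exp_add)
    qed
    also have "\<dots> \<le> exp (l\<^sup>2 / 4) * exp ((1 - l) * ln a + l * ln b)"
      unfolding sum_distrib_left[symmetric]
      by (intro mult_left_mono sum_exp_mix_le l a b G F) auto
    also have "\<dots> \<le> b * (2 - r)" by (rule opt)
    finally show ?thesis using cardC by (simp add: b_def field_simps)
  qed
  ultimately show ?thesis unfolding Y_def N_def r_def by blast
qed

text \<open>Let n, m, M be the sizes of \<open>X\<close>, \<open>A\<close> and the largest fibre of
  \<open>A\<close>. The fibre bounds add up to N (2n - m/M), and (m/M)(2n - m/M) <= n^2 because the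
  difference is a square; n^2 N is the squared factorial of n.\<close>

lemma concentrated_step:
  assumes X: "finite X" "p \<in> X" and conc: "concentrated (X - {p})"
    and A: "A \<subseteq> {\<sigma>. \<sigma> permutes X}" "A \<noteq> {}"
  shows "\<exists>\<nu>. (\<forall>\<sigma>. set_pmf (\<nu> \<sigma>) \<subseteq> A) \<and>
      real (card A) * (\<Sum>\<sigma> | \<sigma> permutes X. exp (mismatch_cost X p (\<nu> \<sigma>) \<sigma> / 16))
        \<le> (fact (card X))\<^sup>2"
proof -
  define Y where "Y = X - {p}"
  define N :: real where "N = (fact (card Y))\<^sup>2"
  define B where "B = (\<lambda>i. {\<pi>. \<pi> permutes Y \<and> transpose p i \<circ> \<pi> \<in> A})"
  define \<Phi> where "\<Phi> = (\<lambda>(i, \<rho>). transpose p i \<circ> \<rho> :: 'a \<Rightarrow> 'a)"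
  note bij = bij_betw_transpose_permutes[OF X(2), folded Y_def \<Phi>_def]
  have finP: "finite {\<rho>. \<rho> permutes Y}" using X by (simp add: Y_def finite_permutations)
  have finA: "finite A" using A X finite_permutations finite_subset by blast
  have finB: "finite (B i)" for i using finP by (simp add: B_def)
  have "bij_betw \<Phi> (Sigma X B) A"
  proof (rule bij_betw_subset[OF bij])
    show "Sigma X B \<subseteq> X \<times> {\<rho>. \<rho> permutes Y}" by (auto simp: B_def)
    show "\<Phi> ` Sigma X B = A"
    proof
      show "\<Phi> ` Sigma X B \<subseteq> A" by (auto simp: B_def \<Phi>_def)
      show "A \<subseteq> \<Phi> ` Sigma X B"
      proof
        fix \<sigma> assume \<sigma>: "\<sigma> \<in> A"
        then have "\<sigma> \<in> \<Phi> ` (X \<times> {\<rho>. \<rho> permutes Y})"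
          using bij A by (auto simp: bij_betw_def)
        then show "\<sigma> \<in> \<Phi> ` Sigma X B" using \<sigma> by (force simp: B_def \<Phi>_def)
      qed
    qed
  qed
  then have "card (Sigma X B) = card A" by (rule bij_betw_same_card)
  then have cardA: "card A = (\<Sum>i\<in>X. card (B i))" using X(1) finB by simp
  \<comment> \<open>The largest fibre is the common partner of all others, which keeps every ratio r
    at most 1.\<close>
  obtain j where j: "j \<in> X" "card (B j) = Max ((\<lambda>i. card (B i)) ` X)"
    using X by (metis obtains_MAX empty_iff)
  have max: "card (B i) \<le> card (B j)" if "i \<in> X" for i
    unfolding j(2) using that X by (intro Max_ge) auto
  have "B j \<noteq> {}"
  proof
    assume "B j = {}"
    then have "card A = 0" using max cardA by auto
    then show False using finA A by simp
  qed
  define M where "M = real (card (B j))"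
  have M: "0 < M" using finB \<open>B j \<noteq> {}\<close> by (simp add: M_def card_gt_0_iff)
  define good where "good = (\<lambda>i \<nu>. (\<forall>\<rho>. set_pmf (\<nu> \<rho>) \<subseteq> A) \<and>
    M * (\<Sum>\<rho> | \<rho> permutes Y. exp (mismatch_cost X p (\<nu> \<rho>) (transpose p i \<circ> \<rho>) / 16))
      \<le> N * (2 - real (card (B i)) / M))"
  have "\<exists>\<nu>. good i \<nu>" if "i \<in> X" for i
    using concentrated_fibre[OF X that j(1) conc, of "B i" A "B j"] max that \<open>B j \<noteq> {}\<close>
    unfolding good_def Y_def[symmetric] N_def M_def by (auto simp: B_def)
  then obtain \<nu> where "\<And>i. i \<in> X \<Longrightarrow> good i (\<nu> i)" by metis
  then have \<nu>: "\<And>i \<rho>. i \<in> X \<Longrightarrow> set_pmf (\<nu> i \<rho>) \<subseteq> A"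
    "\<And>i. i \<in> X \<Longrightarrow>
      M * (\<Sum>\<rho> | \<rho> permutes Y. exp (mismatch_cost X p (\<nu> i \<rho>) (transpose p i \<circ> \<rho>) / 16))
      \<le> N * (2 - real (card (B i)) / M)"
    unfolding good_def by auto
  obtain \<alpha> where \<alpha>: "\<alpha> \<in> A" using A by blast
  \<comment> \<open>\<open>transpose p (\<sigma> p) \<circ> \<sigma>\<close> recovers the second
    coordinate of \<sigma>. The default point mass is reached only by functions that do not permute
    \<open>X\<close>, where a measure on \<open>A\<close> is still demanded.\<close>
  define \<kappa> where "\<kappa> = (\<lambda>\<sigma>. if \<sigma> p \<in> X then \<nu> (\<sigma> p) (transpose p (\<sigma> p) \<circ> \<sigma>) else return_pmf \<alpha>)"
  have \<kappa>: "\<kappa> (transpose p i \<circ> \<rho>) = \<nu> i \<rho>" if "i \<in> X" "\<rho> permutes Y" for i \<rho>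
  proof -
    have "\<rho> p = p" using that by (simp add: Y_def permutes_def)
    then show ?thesis using that by (simp add: \<kappa>_def flip: comp_assoc)
  qed
  define n m where "n = real (card X)" and "m = real (card A)"
  have "M * (\<Sum>\<sigma> | \<sigma> permutes X. exp (mismatch_cost X p (\<kappa> \<sigma>) \<sigma> / 16))
      = M * (\<Sum>(i, \<rho>)\<in>X \<times> {\<rho>. \<rho> permutes Y}.
          exp (mismatch_cost X p (\<nu> i \<rho>) (transpose p i \<circ> \<rho>) / 16))"
    by (subst sum.reindex_bij_betw[OF bij, symmetric])
       (auto intro!: sum.cong simp: \<Phi>_def \<kappa>)
  also have "\<dots> = (\<Sum>i\<in>X. M * (\<Sum>\<rho> | \<rho> permutes Y.
          exp (mismatch_cost X p (\<nu> i \<rho>) (transpose p i \<circ> \<rho>) / 16)))"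
    by (simp add: sum.cartesian_product flip: sum_distrib_left)
  also have "\<dots> \<le> (\<Sum>i\<in>X. N * (2 - real (card (B i)) / M))"
    by (intro sum_mono \<nu>(2))
  also have "\<dots> = N * (2 * n - m / M)"
    by (simp add: n_def m_def cardA sum_subtractf flip: sum_distrib_left sum_divide_distrib)
  finally have *: "M * (\<Sum>\<sigma> | \<sigma> permutes X. exp (mismatch_cost X p (\<kappa> \<sigma>) \<sigma> / 16))
      \<le> N * (2 * n - m / M)" .
  have "m * (\<Sum>\<sigma> | \<sigma> permutes X. exp (mismatch_cost X p (\<kappa> \<sigma>) \<sigma> / 16))
      = m / M * (M * (\<Sum>\<sigma> | \<sigma> permutes X. exp (mismatch_cost X p (\<kappa> \<sigma>) \<sigma> / 16)))"
    using M by simp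
  also have "\<dots> \<le> m / M * (N * (2 * n - m / M))"
    using * M by (intro mult_left_mono) (auto simp: m_def)
  also have "\<dots> = N * (n\<^sup>2 - (n - m / M)\<^sup>2)"
    by (simp add: power2_eq_square algebra_simps)
  also have "\<dots> \<le> N * n\<^sup>2" by (intro mult_left_mono) (auto simp: N_def)
  also have "\<dots> = (fact (card X))\<^sup>2"
  proof -
    have "card X = Suc (card Y)" using X unfolding Y_def by (metis card_Suc_Diff1)
    then show ?thesis by (simp add: N_def n_def power_mult_distrib)
  qed
  finally have "m * (\<Sum>\<sigma> | \<sigma> permutes X. exp (mismatch_cost X p (\<kappa> \<sigma>) \<sigma> / 16)) \<le> (fact (card X))\<^sup>2" .
  moreover have "set_pmf (\<kappa> \<sigma>) \<subseteq> A" for \<sigma>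
    using \<nu>(1) \<alpha> by (auto simp: \<kappa>_def)
  ultimately show ?thesis unfolding m_def by blast
qed

lemma mismatch_cost_notin_le:
  assumes "q \<notin> X"
  shows "mismatch_cost X q \<nu> \<sigma> \<le> mismatch_cost X p \<nu> \<sigma>"
  using assms unfolding mismatch_cost_def by (intro sum_mono) auto

lemma concentrated_finite:
  assumes "finite X"
  shows "concentrated X"
  using assms
proof (induction rule: finite_remove_induct)
  case empty
  show ?case by (rule concentrated_empty)
next
  case (remove X)
  show ?case unfolding concentrated_def
  proof (intro allI impI)
    fix A :: "('a \<Rightarrow> 'a) set" and q
    assume A: "A \<subseteq> {\<sigma>. \<sigma> permutes X}" "A \<noteq> {}"
    \<comment> \<open>If \<open>q\<close> lies outside \<open>X\<close>, any \<open>p\<close> in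
      \<open>X\<close> will do: doubling a weight only raises the cost.\<close>
    obtain p where p: "p \<in> X" "q \<in> X \<Longrightarrow> q = p"
      using remove.hyps by (metis ex_in_conv)
    have le: "mismatch_cost X q \<nu> \<sigma> \<le> mismatch_cost X p \<nu> \<sigma>"
      for \<nu> :: "('a \<Rightarrow> 'a) pmf" and \<sigma>
      using p mismatch_cost_notin_le by (cases "q \<in> X") auto
    obtain \<nu> where \<nu>: "\<forall>\<sigma>. set_pmf (\<nu> \<sigma>) \<subseteq> A"
      "real (card A) * (\<Sum>\<sigma> | \<sigma> permutes X. exp (mismatch_cost X p (\<nu> \<sigma>) \<sigma> / 16))
        \<le> (fact (card X))\<^sup>2"
      using concentrated_step[OF \<open>finite X\<close> p(1) _ A] remove.IH[OF p(1)] by blast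
    have "real (card A) * (\<Sum>\<sigma> | \<sigma> permutes X. exp (mismatch_cost X q (\<nu> \<sigma>) \<sigma> / 16))
      \<le> real (card A) * (\<Sum>\<sigma> | \<sigma> permutes X. exp (mismatch_cost X p (\<nu> \<sigma>) \<sigma> / 16))"
      using le by (intro mult_left_mono sum_mono) (auto simp: divide_right_mono)
    with \<nu> show "\<exists>\<nu>. (\<forall>\<sigma>. set_pmf (\<nu> \<sigma>) \<subseteq> A) \<and>
      real (card A) * (\<Sum>\<sigma> | \<sigma> permutes X. exp (mismatch_cost X q (\<nu> \<sigma>) \<sigma> / 16))
        \<le> (fact (card X))\<^sup>2"
      by (meson order_trans)
  qed
qed

section \<open>From mismatch costs to the convex distance\<close>

text \<open>Some point in the support of \<nu> has weighted distance at most the \<nu>-mean. That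
  mean is the inner product of the absolute weights with the mismatch vector, and Cauchy-Schwarz
  bounds it uniformly over unit weights.\<close>

lemma convex_dist_le:
  assumes "set_pmf \<nu> \<subseteq> A" "finite A"
  shows "convex_dist n \<sigma> A \<le> ereal (L2_set (mismatch \<nu> \<sigma>) {1..n})"
  unfolding convex_dist_def
proof (rule SUP_least)
  fix \<alpha> :: "nat \<Rightarrow> real"
  assume \<alpha>: "\<alpha> \<in> {\<alpha>. L2_set \<alpha> {1..n} = 1}"
  define h where "h = (\<lambda>\<tau>. \<Sum>i=1..n. \<bar>\<alpha> i\<bar> * of_bool (\<sigma> i \<noteq> \<tau> i))"
  have fin: "finite (set_pmf \<nu>)" using assms finite_subset by blast
  obtain \<tau> where \<tau>: "\<tau> \<in> set_pmf \<nu>" "h \<tau> \<le> measure_pmf.expectation \<nu> h"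
  proof (rule ccontr)
    assume "\<not> thesis"
    then have *: "\<And>\<tau>. \<tau> \<in> set_pmf \<nu> \<Longrightarrow> measure_pmf.expectation \<nu> h < h \<tau>"
      using that by force
    have "measure_pmf.expectation \<nu> (\<lambda>_. measure_pmf.expectation \<nu> h) < measure_pmf.expectation \<nu> h"
      using * fin by (intro measure_pmf.integral_less_AE_space integrable_measure_pmf_finite) (auto simp: AE_measure_pmf_iff)
    then show False by simp
  qed
  have "weighted_hamming_dist n \<alpha> \<sigma> A \<le> ereal (h \<tau>)"
    unfolding weighted_hamming_dist_def h_def using \<tau>(1) assms by (intro INF_lower) auto
  also have "h \<tau> \<le> (\<Sum>i=1..n. \<bar>\<alpha> i\<bar> * mismatch \<nu> \<sigma> i)"
  proof -
    have "measure_pmf.expectation \<nu> h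
        = (\<Sum>i=1..n. measure_pmf.expectation \<nu> (\<lambda>\<tau>. \<bar>\<alpha> i\<bar> * of_bool (\<sigma> i \<noteq> \<tau> i)))"
      unfolding h_def using fin by (intro Bochner_Integration.integral_sum integrable_measure_pmf_finite)
    also have "\<dots> = (\<Sum>i=1..n. \<bar>\<alpha> i\<bar> * mismatch \<nu> \<sigma> i)"
    proof (rule sum.cong[OF refl])
      fix i
      have "(\<lambda>\<tau>. of_bool (\<sigma> i \<noteq> \<tau> i) :: real) = indicator {\<tau>. \<tau> i \<noteq> \<sigma> i}"
        by (auto simp: indicator_def)
      then show "measure_pmf.expectation \<nu> (\<lambda>\<tau>. \<bar>\<alpha> i\<bar> * of_bool (\<sigma> i \<noteq> \<tau> i)) = \<bar>\<alpha> i\<bar> * mismatch \<nu> \<sigma> i"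
        unfolding mismatch_def by (simp only: integral_mult_right_zero) simp
    qed
    finally show ?thesis using \<tau>(2) by simp
  qed
  also have "\<dots> \<le> L2_set \<alpha> {1..n} * L2_set (mismatch \<nu> \<sigma>) {1..n}"
    using L2_set_mult_ineq[of \<alpha> "mismatch \<nu> \<sigma>" "{1..n}"] by (simp add: mismatch_nonneg)
  finally show "weighted_hamming_dist n \<alpha> \<sigma> A \<le> ereal (L2_set (mismatch \<nu> \<sigma>) {1..n})"
    using \<alpha> by simp
qed

text \<open>Markov's inequality for the exponential moment; dividing by the squared factorial of
  \<open>n\<close> turns both cardinalities into probabilities.\<close>

lemma talagrand_permutations:
  assumes A: "A \<subseteq> sym_perms n" and t: "0 \<le> t"
  shows "measure_pmf.prob (uniform_perm n) A *
      measure_pmf.prob (uniform_perm n) {\<sigma> \<in> sym_perms n. convex_dist n \<sigma> A \<ge> ereal t}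
    \<le> exp (- (t\<^sup>2 / 16))"
proof (cases "A = {}")
  case True
  then show ?thesis by simp
next
  case False
  define S where "S = sym_perms n"
  have S: "S = {\<sigma>. \<sigma> permutes {1..n}}" by (simp add: S_def sym_perms_def)
  have finS: "finite S" and cardS: "card S = fact n"
    unfolding S using card_permutations[of "{1..n}" n] finite_permutations[of "{1..n}"] by auto
  have neS: "S \<noteq> {}" using A False by (auto simp: S_def)
  have finA: "finite A" using A finS finite_subset unfolding S_def by blast
  define T where "T = {\<sigma> \<in> S. convex_dist n \<sigma> A \<ge> ereal t}"
  have prob: "measure_pmf.prob (uniform_perm n) E = real (card E) / fact n" if "E \<subseteq> S" for E
    using that finS neS
    by (simp add: uniform_perm_def measure_pmf_of_set Int_absorb1 cardS flip: S_def)
  \<comment> \<open>The index 0 lies outside \<open>{1..n}\<close>, so the cost is the plain squared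
    norm.\<close>
  obtain \<nu> where \<nu>: "\<And>\<sigma>. set_pmf (\<nu> \<sigma>) \<subseteq> A"
    "real (card A) * (\<Sum>\<sigma>\<in>S. exp (mismatch_cost {1..n} 0 (\<nu> \<sigma>) \<sigma> / 16)) \<le> (fact n)\<^sup>2"
    using concentratedD[OF concentrated_finite[of "{1..n}"] A[unfolded sym_perms_def] False, of 0]
    unfolding S by auto
  have "exp (t\<^sup>2 / 16) \<le> exp (mismatch_cost {1..n} 0 (\<nu> \<sigma>) \<sigma> / 16)" if "\<sigma> \<in> T" for \<sigma>
  proof -
    have "ereal t \<le> ereal (L2_set (mismatch (\<nu> \<sigma>) \<sigma>) {1..n})"
      using that order_trans[OF _ convex_dist_le[OF \<nu>(1) finA]] unfolding T_def by blast
    then have "t\<^sup>2 \<le> (L2_set (mismatch (\<nu> \<sigma>) \<sigma>) {1..n})\<^sup>2"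
      using t by (intro power_mono) auto
    also have "\<dots> = (\<Sum>x=1..n. (mismatch (\<nu> \<sigma>) \<sigma> x)\<^sup>2)"
      by (simp add: L2_set_def sum_nonneg)
    also have "\<dots> \<le> mismatch_cost {1..n} 0 (\<nu> \<sigma>) \<sigma>" by (rule sum_mismatch_le_cost)
    finally show ?thesis by simp
  qed
  then have "real (card T) * exp (t\<^sup>2 / 16)
      \<le> (\<Sum>\<sigma>\<in>T. exp (mismatch_cost {1..n} 0 (\<nu> \<sigma>) \<sigma> / 16))"
    by (intro sum_bounded_below)
  also have "\<dots> \<le> (\<Sum>\<sigma>\<in>S. exp (mismatch_cost {1..n} 0 (\<nu> \<sigma>) \<sigma> / 16))"
    using finS by (intro sum_mono2) (auto simp: T_def)
  finally have "real (card A) * (real (card T) * exp (t\<^sup>2 / 16)) \<le> (fact n)\<^sup>2"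
    using \<nu>(2) by (meson mult_left_mono of_nat_0_le_iff order_trans)
  then have "real (card A) / fact n * (real (card T) / fact n) \<le> exp (- (t\<^sup>2 / 16))"
    by (simp add: exp_minus field_simps power2_eq_square)
  moreover have "A \<subseteq> S" "T \<subseteq> S" using A by (auto simp: S_def T_def)
  ultimately show ?thesis by (simp add: prob T_def flip: S_def)
qed

theorem proposition1p9:
  fixes n :: nat and A :: "(nat \<Rightarrow> nat) set" and t :: real
  assumes "A \<subseteq> sym_perms n"
    and "measure_pmf.prob (uniform_perm n) A \<ge> 1 / 2"
    and "t \<ge> 0"
  shows "measure_pmf.prob (uniform_perm n) {\<sigma> \<in> sym_perms n. convex_dist n \<sigma> A \<ge> ereal t}
           \<le> 2 * exp (- (t\<^sup>2 / 64))"
proof -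
  let ?P = "measure_pmf.prob (uniform_perm n) {\<sigma> \<in> sym_perms n. convex_dist n \<sigma> A \<ge> ereal t}"
  \<comment> \<open>The lower bound on the probability of \<open>A\<close> becomes the factor
    2.\<close>
  have "1 / 2 * ?P \<le> measure_pmf.prob (uniform_perm n) A * ?P"
    using assms(2) by (intro mult_right_mono) auto
  also have "\<dots> \<le> exp (- (t\<^sup>2 / 16))" by (rule talagrand_permutations[OF assms(1,3)])
  also have "\<dots> \<le> exp (- (t\<^sup>2 / 64))" by simp
  finally show ?thesis by simp
qed

end
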